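(* Let $r\ge 1$, $\mathbb A=\{1,\dots,r\}$, and let $t,q$ be indeterminates. Then $$[\mathrm{Ferm}(t,q)\times\mathrm{Bos}(t,q)]_{SF_q}=1,$$ where $[\ \cdot\ ]_{SF_q}$ is the leftmost reduction associated with $SF_q$, and $\mathrm{Ferm}(t,q)$, $\mathrm{Bos}(t,q)$, $SF_q$ are as defined in the context.
   Context: A biword on $\mathbb A$ is a $2\times n$ matrix $\binom{x_1\cdots x_n}{a_1\cdots a_n}$ ($n\ge0$) with entries in $\mathbb A$. The first row is its top word and the second row its bottom word; $n$ is its length. A biword is viewed as a word in biletters $\binom{x_i}{a_i}$, and biwords are multiplied by concatenation; the empty biword is $1$. Let $\mathcal B$ be the set of biwords. Let $K=\mathbb Z[t,t^{-1},q,q^{-1}]$ and let $K\langle\langle\mathcal B\rangle\rangle$ be the algebra of formal sums $\sum_\alpha c(\alpha)\alpha$ with $c(\alpha)\in K$. For a word $w=w_1\cdots w_m$, $\mathrm{inv}\,w$ is the number of pairs $i<j$ with $w_i>w_j$, and $\overline w$ is the nondecreasing rearrangement of $w$. For a biword $\alpha=\binom{x_1\cdots x_n}{a_1\cdots a_n}$, $\mathrm{exc}\,\alpha=\#\{i:a_i>x_i\}$. Define $$\mathrm{Bos}(t,q)=\sum_{w\in\mathbb A^*}t^{\mathrm{exc}\binom{\overline w}{w}}q^{\mathrm{inv}\,w}\binom{\overline w}{w}$$ and $$\mathrm{Ferm}(t,q)=\sum_{J\subseteq\mathbb A}(-1)^{|J|}\sum_{\sigma\in\mathfrak S_J}t^{\mathrm{exc}\,\alpha_\sigma}(-q)^{-\mathrm{inv}\,\sigma}\alpha_\sigma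 .$$ Here $J=\{i_1<\dots<i_l\}$, $\alpha_\sigma=\binom{\sigma(i_1)\cdots\sigma(i_l)}{i_1\cdots i_l}$, and $\mathrm{inv}\,\sigma=\mathrm{inv}(\sigma(i_1)\cdots\sigma(i_l))$. The term $J=\emptyset$ contributes $1$. The reduction system $SF_q$ is the set of pairs $(\alpha,E_\alpha)$ given as follows, for all $x>y$ in $\mathbb A$: - $(\binom{xy}{ab},\binom{yx}{ba})$ if $a>b$; - $(\binom{xy}{ab},q\binom{yx}{ba})$ if $a=b$; - $(\binom{xy}{ab},q^2\binom{yx}{ba})$ if $a<b$. A biword is irreducible if none of its factors of consecutive biletters is a first component $\alpha$ of $SF_q$. The leftmost reduction $[\ \cdot\ ]_{SF_q}$ is the $K$-linear map (applied termwise to infinite sums) defined as follows: - $[\beta]=\beta$ for irreducible $\beta$; - otherwise write uniquely $\beta=\beta_1\beta_2\binom{x}{a}\beta_3$ with $\beta_1\beta_2$ irreducible and $\beta_2\binom{x}{a}=\alpha$ a first component, and set $[\beta]=[\beta_1E_\alpha\beta_3]$ (extended linearly). This process terminates. *)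

theory Defs
  imports
    "HOL-Library.Poly_Mapping"
    "HOL-Library.Product_Plus"
    "HOL-Library.Multiset"
    "HOL-Combinatorics.Permutations"
begin

text \<open>
  The ring of Laurent polynomials in two variables over the integers, as the group ring of
  \<open>int \<times> int\<close>: the exponent pair \<open>(i, j)\<close> stands for the monomial \<open>t\<^sup>i q\<^sup>j\<close>.
  The multiplication of \<^type>\<open>poly_mapping\<close> is convolution.
\<close>

type_synonym laurent = "(int \<times> int) \<Rightarrow>\<^sub>0 int"

definition t_var :: laurent where
  "t_var = Poly_Mapping.single (1, 0) 1"

definition q_var :: laurent where
  "q_var = Poly_Mapping.single (0, 1) 1"

definition q_inv :: laurent where
  "q_inv = Poly_Mapping.single (0, -1) 1"

lemma q_var_q_inv: "q_var * q_inv = 1"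
  by (simp add: q_var_def q_inv_def mult_single zero_prod_def[symmetric])

text \<open>
  A biletter is the pair of its top and its bottom entry. A formal sum of biwords is its
  coefficient function.
\<close>

type_synonym biword = "(nat \<times> nat) list"
type_synonym series = "biword \<Rightarrow> laurent"

definition alphabet :: "nat \<Rightarrow> nat set" where
  "alphabet r = {1..r}"

definition series_one :: series where
  "series_one = (\<lambda>\<alpha>. if \<alpha> = [] then 1 else 0)"

definition series_mult :: "series \<Rightarrow> series \<Rightarrow> series" where
  "series_mult F G = (\<lambda>\<alpha>. \<Sum>(\<beta>, \<gamma>)\<in>{(\<beta>, \<gamma>). \<beta> @ \<gamma> = \<alpha>}. F \<beta> * G \<gamma>)"

text \<open>
  The formal sum of the terms \<open>c i \<cdot> b i\<close> over \<open>i \<in> I\<close>. It is meaningful if every biword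
  is \<open>b i\<close> for only finitely many \<open>i \<in> I\<close>; \<open>finite_Bos_terms\<close> and \<open>finite_Ferm_terms\<close> below
  show this where it is used.
\<close>

definition formal_sum :: "'i set \<Rightarrow> ('i \<Rightarrow> laurent) \<Rightarrow> ('i \<Rightarrow> biword) \<Rightarrow> series" where
  "formal_sum I c b = (\<lambda>\<alpha>. \<Sum>i\<in>{i \<in> I. b i = \<alpha>}. c i)"

definition word_inv :: "nat list \<Rightarrow> nat" where
  "word_inv w = card {(i, j). i < j \<and> j < length w \<and> w ! i > w ! j}"

definition exc :: "biword \<Rightarrow> nat" where
  "exc \<alpha> = card {i. i < length \<alpha> \<and> snd (\<alpha> ! i) > fst (\<alpha> ! i)}"

definition sorted_biword :: "nat list \<Rightarrow> biword" where
  "sorted_biword w = zip (sort w) w"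

definition Bos :: "nat \<Rightarrow> series" where
  "Bos r = formal_sum (lists (alphabet r))
     (\<lambda>w. t_var ^ exc (sorted_biword w) * q_var ^ word_inv w)
     sorted_biword"

definition perm_biword :: "nat set \<Rightarrow> (nat \<Rightarrow> nat) \<Rightarrow> biword" where
  "perm_biword J \<sigma> = zip (map \<sigma> (sorted_list_of_set J)) (sorted_list_of_set J)"

definition perm_inv :: "nat set \<Rightarrow> (nat \<Rightarrow> nat) \<Rightarrow> nat" where
  "perm_inv J \<sigma> = word_inv (map \<sigma> (sorted_list_of_set J))"

text \<open>The factor \<open>(- q_inv) ^ n\<close> is \<open>(-q)\<close> to the power \<open>-n\<close>.\<close>

definition Ferm :: "nat \<Rightarrow> series" where
  "Ferm r = formal_sum (SIGMA J : Pow (alphabet r). {\<sigma>. \<sigma> permutes J})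
     (\<lambda>(J, \<sigma>). (-1) ^ card J * (t_var ^ exc (perm_biword J \<sigma>) * (- q_inv) ^ perm_inv J \<sigma>))
     (\<lambda>(J, \<sigma>). perm_biword J \<sigma>)"

text \<open>
  Every \<open>E\<^sub>\<alpha>\<close> of the reduction system is a scalar multiple of one biword. The pair
  \<open>(\<alpha>, c \<cdot> \<gamma>)\<close> is encoded as \<open>(\<alpha>, c, \<gamma>)\<close>.
\<close>

definition SFq :: "nat \<Rightarrow> (biword \<times> laurent \<times> biword) set" where
  "SFq r = {([(x, a), (y, b)],
             if a > b then 1 else if a = b then q_var else q_var\<^sup>2,
             [(y, b), (x, a)]) | x y a b.
            x \<in> alphabet r \<and> y \<in> alphabet r \<and> a \<in> alphabet r \<and> b \<in> alphabet r \<and> x > y}"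

definition irreducible_biword :: "nat \<Rightarrow> biword \<Rightarrow> bool" where
  "irreducible_biword r \<beta> \<longleftrightarrow> \<not> (\<exists>\<beta>\<^sub>1 \<alpha> \<beta>\<^sub>3. \<beta> = \<beta>\<^sub>1 @ \<alpha> @ \<beta>\<^sub>3 \<and> \<alpha> \<in> fst ` SFq r)"

definition leftmost_step :: "nat \<Rightarrow> biword \<Rightarrow> laurent \<times> biword \<Rightarrow> bool" where
  "leftmost_step r \<beta> p \<longleftrightarrow>
     (\<exists>\<beta>\<^sub>1 \<beta>\<^sub>2 l \<beta>\<^sub>3 c \<gamma>. \<beta> = \<beta>\<^sub>1 @ \<beta>\<^sub>2 @ [l] @ \<beta>\<^sub>3 \<and> irreducible_biword r (\<beta>\<^sub>1 @ \<beta>\<^sub>2) \<and>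
        (\<beta>\<^sub>2 @ [l], c, \<gamma>) \<in> SFq r \<and> p = (c, \<beta>\<^sub>1 @ \<gamma> @ \<beta>\<^sub>3))"

lemma irreducible_biword_prefix:
  "irreducible_biword r (u @ v) \<Longrightarrow> irreducible_biword r u"
  unfolding irreducible_biword_def by (metis append.assoc)

lemma leftmost_step_exists:
  assumes "\<not> irreducible_biword r \<beta>"
  shows "\<exists>p. leftmost_step r \<beta> p"
  using assms
proof (induction \<beta> rule: rev_induct)
  case Nil
  then show ?case by (auto simp: irreducible_biword_def SFq_def)
next
  case (snoc l \<beta>)
  show ?case
  proof (cases "irreducible_biword r \<beta>")
    case False
    then obtain p where "leftmost_step r \<beta> p" using snoc.IH by blast
    then obtain \<beta>1 \<beta>2 l' \<beta>3 c \<gamma> where *: "\<beta> = \<beta>1 @ \<beta>2 @ [l'] @ \<beta>3"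
      "irreducible_biword r (\<beta>1 @ \<beta>2)" "(\<beta>2 @ [l'], c, \<gamma>) \<in> SFq r"
      unfolding leftmost_step_def by blast
    have "\<beta> @ [l] = \<beta>1 @ \<beta>2 @ [l'] @ (\<beta>3 @ [l])" using *(1) by simp
    with *(2,3) show ?thesis unfolding leftmost_step_def by blast
  next
    case True
    from snoc.prems obtain u \<alpha> v c \<gamma> where *: "\<beta> @ [l] = u @ \<alpha> @ v" "(\<alpha>, c, \<gamma>) \<in> SFq r"
      unfolding irreducible_biword_def by (auto simp: image_iff)
    have "v = []"
    proof (rule ccontr)
      assume "v \<noteq> []"
      then have "\<beta> = u @ \<alpha> @ butlast v"
        using *(1) by (metis append_is_Nil_conv butlast_append butlast_snoc)
      with *(2) True show False unfolding irreducible_biword_def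
        by (metis fst_conv image_eqI)
    qed
    moreover have "\<alpha> \<noteq> []" using *(2) by (auto simp: SFq_def)
    ultimately have "\<alpha> = butlast \<alpha> @ [l]" "\<beta> = u @ butlast \<alpha>"
      using *(1) by (metis append_Nil2 append_butlast_last_id last_appendR last_snoc,
                     metis append_Nil2 butlast_append butlast_snoc *(1) \<open>\<alpha> \<noteq> []\<close> \<open>v = []\<close>)
    then have "\<beta> @ [l] = u @ butlast \<alpha> @ [l] @ []" "irreducible_biword r (u @ butlast \<alpha>)"
      "(butlast \<alpha> @ [l], c, \<gamma>) \<in> SFq r"
      using True *(2) by auto
    then show ?thesis unfolding leftmost_step_def by blast
  qed
qed

lemma leftmost_step_unique:
  assumes "leftmost_step r \<beta> p" "leftmost_step r \<beta> p'"
  shows "p = p'"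
proof -
  obtain u1 u2 l u3 c \<gamma> where u: "\<beta> = u1 @ u2 @ [l] @ u3" "irreducible_biword r (u1 @ u2)"
    "(u2 @ [l], c, \<gamma>) \<in> SFq r" "p = (c, u1 @ \<gamma> @ u3)"
    using assms(1) unfolding leftmost_step_def by blast
  obtain v1 v2 m v3 d \<delta> where v: "\<beta> = v1 @ v2 @ [m] @ v3" "irreducible_biword r (v1 @ v2)"
    "(v2 @ [m], d, \<delta>) \<in> SFq r" "p' = (d, v1 @ \<delta> @ v3)"
    using assms(2) unfolding leftmost_step_def by blast
  have le: "length (y1 @ y2) \<le> length (x1 @ x2)"
    if "x1 @ x2 @ [k] @ x3 = y1 @ y2 @ [k'] @ y3" "irreducible_biword r (y1 @ y2)"
      "(x2 @ [k], e, \<epsilon>) \<in> SFq r"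
    for x1 x2 k x3 y1 y2 k' y3 e \<epsilon>
  proof (rule ccontr)
    assume "\<not> ?thesis"
    then have len: "length (x1 @ x2 @ [k]) \<le> length (y1 @ y2)" by simp
    have "(x1 @ x2 @ [k]) @ x3 = (y1 @ y2) @ ([k'] @ y3)" using that(1) by simp
    then have "y1 @ y2 = take (length (y1 @ y2)) ((x1 @ x2 @ [k]) @ x3)"
      by (metis append_eq_conv_conj)
    also have "\<dots> = (x1 @ x2 @ [k]) @ take (length (y1 @ y2) - length (x1 @ x2 @ [k])) x3"
      using len by (subst take_append) (simp only: take_all)
    finally obtain z where "y1 @ y2 = x1 @ (x2 @ [k]) @ z" by (metis append.assoc)
    with that(2,3) show False unfolding irreducible_biword_def
      by (metis fst_conv image_eqI)
  qed
  have eq: "u1 @ u2 @ [l] @ u3 = v1 @ v2 @ [m] @ v3" using u(1) v(1) by simp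
  have "length (u1 @ u2) = length (v1 @ v2)"
    using le[OF eq v(2) u(3)] le[OF eq[symmetric] u(2) v(3)] by (rule le_antisym[rotated])
  moreover have len: "length u2 = 1" "length v2 = 1"
    using u(3) v(3) unfolding SFq_def by (auto simp: append_eq_Cons_conv)
  ultimately have "u1 = v1 \<and> u2 = v2 \<and> l = m \<and> u3 = v3"
    using u(1) v(1) by auto
  moreover from this have "c = d \<and> \<gamma> = \<delta>" using u(3) v(3) by (auto simp: SFq_def)
  ultimately show ?thesis using u(4) v(4) by simp
qed

lemma leftmost_step_The:
  assumes "\<not> irreducible_biword r \<beta>"
  shows "leftmost_step r \<beta> (THE p. leftmost_step r \<beta> p)"
  using leftmost_step_exists[OF assms] leftmost_step_unique by (metis theI)

lemma leftmost_step_mset: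
  "leftmost_step r \<beta> (c, \<beta>') \<Longrightarrow> mset \<beta>' = mset \<beta>"
  unfolding leftmost_step_def SFq_def by (auto simp: append_eq_Cons_conv)

lemma leftmost_step_decreasing:
  assumes "leftmost_step r \<beta> (c, \<beta>')"
  shows "(map fst \<beta>', map fst \<beta>) \<in> lex less_than"
  using assms unfolding leftmost_step_def SFq_def
  by (auto simp: append_eq_Cons_conv intro!: lex_append_leftI)

function red_biword :: "nat \<Rightarrow> biword \<Rightarrow> series" where
  "red_biword r \<beta> =
     (if irreducible_biword r \<beta> then (\<lambda>\<delta>. if \<delta> = \<beta> then 1 else 0)
      else (case THE p. leftmost_step r \<beta> p of (c, \<beta>') \<Rightarrow> (\<lambda>\<delta>. c * red_biword r \<beta>' \<delta>)))"
  by auto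
termination
proof (relation "inv_image (lex less_than) (\<lambda>(r, \<beta>). map fst \<beta>)")
  show "wf (inv_image (lex less_than) (\<lambda>(r :: nat, \<beta> :: biword). map fst \<beta>))"
    by (intro wf_inv_image wf_lex wf_less_than)
next
  fix r \<beta> c \<beta>'
  assume "\<not> irreducible_biword r \<beta>" "(c, \<beta>') = (THE p. leftmost_step r \<beta> p)"
  then have "leftmost_step r \<beta> (c, \<beta>')" using leftmost_step_The by metis
  then show "((r, \<beta>'), (r, \<beta>)) \<in> inv_image (lex less_than) (\<lambda>(r, \<beta>). map fst \<beta>)"
    using leftmost_step_decreasing by simp
qed

declare red_biword.simps [simp del]

lemma red_biword_irreducible:
  "irreducible_biword r \<beta> \<Longrightarrow> red_biword r \<beta> = (\<lambda>\<delta>. if \<delta> = \<beta> then 1 else 0)"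
  by (simp add: red_biword.simps)

lemma red_biword_step:
  assumes "leftmost_step r \<beta> (c, \<beta>')"
  shows "red_biword r \<beta> = (\<lambda>\<delta>. c * red_biword r \<beta>' \<delta>)"
proof -
  have "\<not> irreducible_biword r \<beta>"
    using assms unfolding leftmost_step_def irreducible_biword_def
    by (metis append.assoc fst_conv image_eqI)
  moreover have "(THE p. leftmost_step r \<beta> p) = (c, \<beta>')"
    using assms leftmost_step_unique by blast
  ultimately show ?thesis by (subst red_biword.simps) simp
qed

lemma red_biword_mset: "red_biword r \<beta> \<delta> \<noteq> 0 \<Longrightarrow> mset \<beta> = mset \<delta>"
proof (induction r \<beta> rule: red_biword.induct)
  case (1 r \<beta>)
  show ?case
  proof (cases "irreducible_biword r \<beta>")
    case True
    then show ?thesis using "1.prems" by (simp add: red_biword_irreducible split: if_splits)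
  next
    case False
    obtain c \<beta>' where p: "(THE p. leftmost_step r \<beta> p) = (c, \<beta>')" by (cases "THE p. leftmost_step r \<beta> p")
    then have s: "leftmost_step r \<beta> (c, \<beta>')" using leftmost_step_The[OF False] by simp
    then have "red_biword r \<beta>' \<delta> \<noteq> 0" using "1.prems" by (auto simp: red_biword_step)
    then show ?thesis using "1.IH"[OF False _ ] p leftmost_step_mset[OF s] by metis
  qed
qed

text \<open>
  The termwise extension of the reduction to formal sums; by the following lemma only finitely
  many biwords contribute to each coefficient.
\<close>

lemma finite_red_biword_support: "finite {\<beta>. red_biword r \<beta> \<delta> \<noteq> 0}"
proof (rule finite_subset)
  show "{\<beta>. red_biword r \<beta> \<delta> \<noteq> 0} \<subseteq> {\<beta>. set \<beta> \<subseteq> set \<delta> \<and> length \<beta> = length \<delta>}"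
    using red_biword_mset mset_eq_setD mset_eq_length by blast
qed (simp add: finite_lists_length_eq)

definition leftmost_reduction :: "nat \<Rightarrow> series \<Rightarrow> series" where
  "leftmost_reduction r F = (\<lambda>\<delta>. \<Sum>\<beta>\<in>{\<beta>. red_biword r \<beta> \<delta> \<noteq> 0}. F \<beta> * red_biword r \<beta> \<delta>)"

lemma finite_Bos_terms: "finite {w \<in> lists (alphabet r). sorted_biword w = \<alpha>}"
proof (rule finite_subset)
  show "{w \<in> lists (alphabet r). sorted_biword w = \<alpha>} \<subseteq> {map snd \<alpha>}"
    by (auto simp: sorted_biword_def)
qed simp

lemma finite_Ferm_terms:
  "finite {i \<in> (SIGMA J : Pow (alphabet r). {\<sigma>. \<sigma> permutes J}). (\<lambda>(J, \<sigma>). perm_biword J \<sigma>) i = \<alpha>}"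
proof (rule finite_subset)
  show "finite (SIGMA J : Pow (alphabet r). {\<sigma>. \<sigma> permutes J})"
    by (rule finite_SigmaI)
      (auto simp: alphabet_def intro: finite_permutations finite_subset)
qed auto

end

theory Submission
  imports Defs "HOL-Combinatorics.Cycles"
begin

text \<open>
  The reduction sorts a biword stably by its top letters, and the power of \<open>q\<close> it produces is
  \<open>inv\<close> of the top word plus the change of \<open>inv\<close> of the bottom word. Since each factor of a term of
  Ferm \<open>\<times>\<close> Bos has equal top and bottom content, every term that reduces to a given biword \<open>\<delta>\<close>
  does so with the same monomial in \<open>t\<close> and \<open>q\<close>, so that only the signs matter. The terms reducing
  to \<open>\<delta>\<close> correspond to the sets \<open>J\<close> of top letters that are permuted by the map \<open>f\<close> sending a top
  letter of \<open>\<delta>\<close> to the first bottom letter under it, with sign \<open>(-1)\<close> to the number of cycles of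
  \<open>f\<close> on \<open>J\<close>. If \<open>\<delta>\<close> is not empty, then \<open>f\<close> has a cycle, and toggling it in \<open>J\<close> cancels the sum.
\<close>

subsection \<open>Inversions and signs\<close>

definition inv_between :: "nat list \<Rightarrow> nat list \<Rightarrow> nat" where
  "inv_between u v = (\<Sum>x\<leftarrow>u. length (filter (\<lambda>y. y < x) v))"

lemma inv_between_Nil [simp]: "inv_between [] v = 0" "inv_between u [] = 0"
  by (simp_all add: inv_between_def)

lemma inv_between_Cons:
  "inv_between (x # u) v = length (filter (\<lambda>y. y < x) v) + inv_between u v"
  by (simp add: inv_between_def)

lemma inv_between_Cons2: "inv_between u (y # v) = length (filter (\<lambda>x. y < x) u) + inv_between u v"
  by (induction u) (simp_all add: inv_between_Cons)

text \<open>Every letter of \<open>u\<close> precedes every letter of \<open>v\<close>, so only the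
  contents matter. This is what equates the cross inversions of the top and the bottom word of a
  product.\<close>

lemma inv_between_mset_cong:
  assumes "mset u = mset u'" "mset v = mset v'"
  shows "inv_between u v = inv_between u' v'"
proof -
  have "inv_between u v = (\<Sum>x\<in>#mset u. size (filter_mset (\<lambda>y. y < x) (mset v)))" for u v
    by (simp add: inv_between_def flip: mset_filter sum_mset_sum_list)
  then show ?thesis using assms by metis
qed

lemma word_inv_Nil [simp]: "word_inv [] = 0"
  by (simp add: word_inv_def)

lemma word_inv_Cons: "word_inv (x # w) = length (filter (\<lambda>y. y < x) w) + word_inv w"
proof -
  \<comment> \<open>\<open>?A\<close> holds the inversions that start at position 0,
    \<open>?B\<close> those of the tail, shifted by one.\<close>
  let ?A = "(\<lambda>j. (0::nat, Suc j)) ` {j. j < length w \<and> w ! j < x}"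
  let ?I = "{(i, j). i < j \<and> j < length w \<and> w ! i > w ! j}"
  let ?B = "(\<lambda>(i, j). (Suc i, Suc j)) ` ?I"
  have eq: "{(i, j). i < j \<and> j < length (x # w) \<and> (x # w) ! i > (x # w) ! j} = ?A \<union> ?B"
  proof (intro equalityI subsetI)
    fix p assume "p \<in> {(i, j). i < j \<and> j < length (x # w) \<and> (x # w) ! i > (x # w) ! j}"
    then obtain i j where p: "p = (i, j)" "i < j" "j < length (x # w)" "(x # w) ! i > (x # w) ! j"
      by blast
    then obtain j' where "j = Suc j'" by (cases j) auto
    with p show "p \<in> ?A \<union> ?B" by (cases i) (auto simp: image_iff)
  qed auto
  have fin: "finite ?I"
    by (rule finite_subset[of _ "{..<length w} \<times> {..<length w}"]) auto
  have "card (?A \<union> ?B) = card ?A + card ?B"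
    by (rule card_Un_disjoint) (use fin in auto)
  also have "card ?A = length (filter (\<lambda>y. y < x) w)"
    by (subst card_image) (auto simp: inj_on_def length_filter_conv_card)
  also have "card ?B = word_inv w"
    by (subst card_image) (auto simp: inj_on_def word_inv_def)
  finally show ?thesis by (simp only: word_inv_def eq)
qed

lemma word_inv_append: "word_inv (u @ v) = word_inv u + word_inv v + inv_between u v"
  by (induction u) (simp_all add: word_inv_Cons inv_between_Cons)

lemma word_inv_sorted: "sorted w \<Longrightarrow> word_inv w = 0"
  by (induction w) (auto simp: word_inv_Cons filter_empty_conv not_less)

text \<open>Only the relative order of the two exchanged letters changes. Equal letters are covered,
  and the form avoids subtraction on \<open>nat\<close>.\<close>

lemma word_inv_swap_adjacent:
  "word_inv (u @ x # y # v) + (if x < y then 1 else 0) =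
   word_inv (u @ y # x # v) + (if y < x then 1 else 0)"
  by (simp add: word_inv_append word_inv_Cons inv_between_Cons2)

section \<open>Transpositions and the parity of inversions\<close>

lemma odd_word_inv_exchange:
  assumes "a \<noteq> b" "a \<notin> set m" "b \<notin> set m"
  shows "odd (word_inv (p @ a # m @ b # s) + word_inv (p @ b # m @ a # s))"
proof -
  have len: "length (filter (\<lambda>y. y < c) m) + length (filter (\<lambda>y. c < y) m) = length m"
    if "c \<notin> set m" for c
    using that by (induction m) auto
  \<comment> \<open>\<open>N\<close> collects what both words share. A letter of \<open>m\<close>
    forms an inversion with \<open>a\<close> in exactly one of the two words, likewise with
    \<open>b\<close>, and the pair \<open>a\<close>, \<open>b\<close> itself adds 1.\<close>
  define N where "N = word_inv p + inv_between p (a # m @ b # s) + word_inv m + word_inv s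
    + inv_between m s + length (filter (\<lambda>y. y < a) s) + length (filter (\<lambda>y. y < b) s)"
  have p: "inv_between p (b # m @ a # s) = inv_between p (a # m @ b # s)"
    by (rule inv_between_mset_cong) auto
  have "word_inv (p @ a # m @ b # s) + word_inv (p @ b # m @ a # s) = 2 * N
    + (length (filter (\<lambda>y. y < a) m) + length (filter (\<lambda>y. a < y) m))
    + (length (filter (\<lambda>y. y < b) m) + length (filter (\<lambda>y. b < y) m)) + 1"
    using assms(1)
    by (simp add: word_inv_append[of p] p N_def)
       (simp add: word_inv_append word_inv_Cons inv_between_Cons2 not_less_iff_gr_or_eq)
  also have "\<dots> = 2 * (N + length m) + 1"
    using len[OF assms(2)] len[OF assms(3)] by simp
  finally show ?thesis by simp
qed

lemma odd_word_inv_transpose: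
  assumes "distinct v" "a \<in> set v" "b \<in> set v" "a \<noteq> b"
  shows "odd (word_inv v + word_inv (map (Transposition.transpose a b) v))"
proof -
  \<comment> \<open>By symmetry of the transposition it suffices to treat \<open>a\<close> standing
    before \<open>b\<close>.\<close>
  have *: "odd (word_inv v + word_inv (map (Transposition.transpose a b) v))"
    if v: "v = p @ a # m @ b # s" and d: "distinct v" for p m s a b
  proof -
    have id: "map (Transposition.transpose a b) w = w" if "a \<notin> set w" "b \<notin> set w" for w
      using that by (auto intro!: map_idI simp: transpose_eq_iff)
    show ?thesis
      using odd_word_inv_exchange[of a b m p s] d unfolding v by (simp add: id)
  qed
  obtain p z where v: "v = p @ a # z" using assms(2) by (metis split_list)
  then consider "b \<in> set p" | "b \<in> set z" using assms by auto
  then show ?thesis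
  proof cases
    case 1
    then obtain k m where "p = k @ b # m" by (metis split_list)
    then have "v = k @ b # m @ a # z" using v by simp
    then show ?thesis using *[of k b m a z] assms(1) by (simp add: transpose_commute)
  next
    case 2
    then obtain m s where "z = m @ b # s" by (metis split_list)
    then show ?thesis using *[of p a m b s] assms(1) v by simp
  qed
qed

text \<open>Transpositions generate the permutations of \<open>set v\<close>, and each one flips
  both the sign and, as the entries are distinct, the inversion parity.\<close>

lemma sign_eq_word_inv_parity:
  assumes "distinct v" "\<sigma> permutes set v"
  shows "(-1) ^ word_inv (map \<sigma> v) = sign \<sigma> * (-1) ^ word_inv v"
  using assms(2) finite_set
proof (induction rule: permutes_induct)
  case id
  then show ?case by (simp add: id_def)
next
  case (swap a b p)
  have "odd (word_inv (map p v) + word_inv (map (Transposition.transpose a b) (map p v)))"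
    using swap assms(1)
    by (intro odd_word_inv_transpose) (auto simp: permutes_image distinct_map permutes_inj_on)
  then have "(-1) ^ word_inv (map (Transposition.transpose a b) (map p v)) =
      (- ((-1) ^ word_inv (map p v)) :: int)"
    by (simp add: minus_one_power_iff)
  moreover have "sign (Transposition.transpose a b \<circ> p) = - sign p"
    using swap(1-5) permutation_permutes[of p]
    by (subst sign_compose) (auto simp: sign_swap_id permutation_swap_id)
  ultimately show ?case using swap.IH by (simp add: o_def)
qed

text \<open>This replaces the sign hidden in \<open>(- q_inv) ^ perm_inv J \<sigma>\<close> by
  \<open>sign \<sigma>\<close>, which is multiplicative and can be evaluated cycle by cycle.\<close>

lemma sign_perm_inv:
  assumes "finite J" "\<sigma> permutes J"
  shows "(-1) ^ perm_inv J \<sigma> = sign \<sigma>"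
  using sign_eq_word_inv_parity[of "sorted_list_of_set J" \<sigma>] assms
  by (simp add: perm_inv_def word_inv_sorted)

text \<open>A cycle of length l is a product of l - 1 transpositions; the sign is written without
  the subtraction.\<close>

lemma sign_cycle_of_list:
  assumes "distinct cs" "cs \<noteq> []"
  shows "sign (cycle_of_list cs) = - ((-1) ^ length cs)"
  using assms
proof (induction cs rule: cycle_of_list.induct)
  case (1 i j cs)
  have "sign (cycle_of_list (i # j # cs)) = - sign (cycle_of_list (j # cs))"
    using 1(2) unfolding cycle_of_list.simps
    by (subst sign_compose) (auto simp: permutation_swap_id permutation_of_cycle sign_swap_id)
  then show ?case using 1 by (simp del: cycle_of_list.simps)
qed auto

subsection \<open>The reduction as a stable sort\<close>

lemma exc_eq_length_filter: "exc \<alpha> = length (filter (\<lambda>p. snd p > fst p) \<alpha>)"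
  by (simp add: exc_def length_filter_conv_card)

lemma exc_append: "exc (\<alpha> @ \<beta>) = exc \<alpha> + exc \<beta>"
  by (simp add: exc_eq_length_filter)

lemma exc_mset_cong: "mset \<alpha> = mset \<beta> \<Longrightarrow> exc \<alpha> = exc \<beta>"
  unfolding exc_eq_length_filter by (metis mset_filter size_mset)

text \<open>Over the alphabet, any two neighbouring biletters with a descent in the top row form a
  first component of \<open>SFq r\<close>.\<close>

lemma irreducible_imp_sorted:
  assumes "irreducible_biword r \<beta>" "set \<beta> \<subseteq> alphabet r \<times> alphabet r"
  shows "sorted (map fst \<beta>)"
proof (rule ccontr)
  assume "\<not> sorted (map fst \<beta>)"
  then obtain i where i: "Suc i < length \<beta>" "fst (\<beta> ! Suc i) < fst (\<beta> ! i)"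
    by (auto simp: sorted_iff_nth_Suc not_le)
  have "\<beta> = take i \<beta> @ [\<beta> ! i, \<beta> ! Suc i] @ drop (Suc (Suc i)) \<beta>"
    using i(1) by (simp add: Cons_nth_drop_Suc)
  moreover have "\<beta> ! i \<in> alphabet r \<times> alphabet r" "\<beta> ! Suc i \<in> alphabet r \<times> alphabet r"
    using assms(2) i(1) by (meson Suc_lessD nth_mem subsetD)+
  then have "[\<beta> ! i, \<beta> ! Suc i] \<in> fst ` SFq r"
    using i(2) unfolding SFq_def by (cases "\<beta> ! i"; cases "\<beta> ! Suc i") (force simp: image_iff)
  ultimately show False using assms(1) unfolding irreducible_biword_def by blast
qed

text \<open>A stable sort is determined by its blocks of equal key; even the multiset can be read
  off from them. Sorted biwords are compared block by block in this way.\<close>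

lemma sort_key_eqI:
  assumes "sorted (map f ys)" "\<And>k. filter (\<lambda>x. f x = k) ys = filter (\<lambda>x. f x = k) xs"
  shows "sort_key f xs = ys"
proof (rule properties_for_sort_key)
  show "mset ys = mset xs"
  proof (rule multiset_eqI)
    fix p
    have "count (mset zs) p = count (mset (filter (\<lambda>x. f x = f p) zs)) p" for zs
      by simp
    then show "count (mset ys) p = count (mset xs) p" using assms(2) by metis
  qed
  show "filter (\<lambda>x. f k = f x) ys = filter (\<lambda>x. f k = f x) xs" for k
    using assms(2)[of "f k"] by (simp add: eq_commute)
qed fact

text \<open>Each step swaps two biletters with distinct tops, so the reduction is a stable sort by top
  letter; its power of \<open>q\<close> is the number of top inversions removed plus the number of bottom
  inversions created.\<close>

lemma red_biword_eq:
  assumes "set \<beta> \<subseteq> alphabet r \<times> alphabet r"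
  obtains k where
    "red_biword r \<beta> = (\<lambda>\<delta>. if \<delta> = sort_key fst \<beta> then q_var ^ k else 0)"
    "k + word_inv (map snd \<beta>) = word_inv (map fst \<beta>) + word_inv (map snd (sort_key fst \<beta>))"
proof -
  have "\<exists>k. red_biword r \<beta> = (\<lambda>\<delta>. if \<delta> = sort_key fst \<beta> then q_var ^ k else 0) \<and>
    k + word_inv (map snd \<beta>) = word_inv (map fst \<beta>) + word_inv (map snd (sort_key fst \<beta>))"
    using assms
  proof (induction r \<beta> rule: red_biword.induct)
    case (1 r \<beta>)
    show ?case
    proof (cases "irreducible_biword r \<beta>")
      case True
      then have s: "sorted (map fst \<beta>)" using "1.prems" by (rule irreducible_imp_sorted)
      then have "sort_key fst \<beta> = \<beta>" by (rule sort_key_eqI) simp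
      then show ?thesis using s True
        by (intro exI[of _ 0]) (auto simp: red_biword_irreducible word_inv_sorted)
    next
      case False
      obtain c \<beta>' where p: "(THE p. leftmost_step r \<beta> p) = (c, \<beta>')"
        by (cases "THE p. leftmost_step r \<beta> p")
      then have s: "leftmost_step r \<beta> (c, \<beta>')" using leftmost_step_The[OF False] by simp
      then obtain u x a y b v where uv: "\<beta> = u @ (x, a) # (y, b) # v"
        "\<beta>' = u @ (y, b) # (x, a) # v" "y < x"
        "c = (if a > b then 1 else if a = b then q_var else q_var\<^sup>2)"
        unfolding leftmost_step_def SFq_def by (auto simp: append_eq_Cons_conv)
      \<comment> \<open>\<open>e\<close> is 1 plus the change of the bottom inversion number, since
        the swap destroys an inversion if \<open>a > b\<close> and creates one if
        \<open>a < b\<close>.\<close>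
      define e :: nat where "e = (if a > b then 0 else if a = b then 1 else 2)"
      have c: "c = q_var ^ e" using uv(4) by (simp add: e_def)
      have "set \<beta>' \<subseteq> alphabet r \<times> alphabet r"
        using "1.prems" leftmost_step_mset[OF s] by (metis mset_eq_setD)
      then obtain k where k: "red_biword r \<beta>' = (\<lambda>\<delta>. if \<delta> = sort_key fst \<beta>' then q_var ^ k else 0)"
        "k + word_inv (map snd \<beta>') = word_inv (map fst \<beta>') + word_inv (map snd (sort_key fst \<beta>'))"
        using "1.IH"[OF False p[symmetric]] by blast
      \<comment> \<open>The swapped biletters have different tops, so no block of equal tops
        changes.\<close>
      have sort: "sort_key fst \<beta> = sort_key fst \<beta>'"
        by (rule sort_key_eqI) (use uv in \<open>auto simp: sort_key_stable\<close>)
      have top: "word_inv (map fst \<beta>) = word_inv (map fst \<beta>') + 1"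
        using word_inv_swap_adjacent[of "map fst u" x y "map fst v"] uv by simp
      have "e + word_inv (map snd \<beta>) = word_inv (map snd \<beta>') + 1"
        using word_inv_swap_adjacent[of "map snd u" a b "map snd v"] uv
        by (auto simp: e_def split: if_splits)
      with top k(2) have "(e + k) + word_inv (map snd \<beta>) =
          word_inv (map fst \<beta>) + word_inv (map snd (sort_key fst \<beta>'))" by simp
      moreover have "red_biword r \<beta> = (\<lambda>\<delta>. if \<delta> = sort_key fst \<beta>' then q_var ^ (e + k) else 0)"
        unfolding red_biword_step[OF s] k(1) c by (auto simp: power_add)
      ultimately show ?thesis unfolding sort by blast
    qed
  qed
  then show thesis using that by blast
qed

subsection \<open>Cancellation along a cycle\<close>

text \<open>Extending by the identity outside \<open>J\<close> is what makes \<open>permutes\<close>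
  and \<open>sign\<close> applicable.\<close>

definition perm_on :: "('a \<Rightarrow> 'a) \<Rightarrow> 'a set \<Rightarrow> 'a \<Rightarrow> 'a" where
  "perm_on f J = (\<lambda>x. if x \<in> J then f x else x)"

lemma perm_on_permutes:
  assumes "bij_betw f J J"
  shows "perm_on f J permutes J"
  by (rule bij_imp_permutes) (use assms in \<open>auto simp: perm_on_def cong: bij_betw_cong\<close>)

text \<open>\<open>C\<close> is a nonempty \<open>f\<close>-closed subset of least size. Minimality
  forces \<open>f\<close> to be onto \<open>C\<close>, an orbit in \<open>C\<close> to be all of
  \<open>C\<close>, and \<open>J \<inter> C\<close>, which is closed whenever \<open>J\<close> is,
  to be empty or \<open>C\<close>.\<close>

lemma minimal_closed_subset_cycle:
  assumes "finite X" "X \<noteq> {}" "f ` X \<subseteq> X"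
  obtains C where "C \<subseteq> X" "C \<noteq> {}" "bij_betw f C C"
    "sign (perm_on f C) = - ((-1) ^ card C)"
    "\<And>J. f ` J \<subseteq> J \<Longrightarrow> J \<inter> C \<noteq> {} \<Longrightarrow> C \<subseteq> J"
proof -
  define P where "P = (\<lambda>C. C \<subseteq> X \<and> C \<noteq> {} \<and> f ` C \<subseteq> C)"
  have "P X" using assms by (simp add: P_def)
  from ex_has_least_nat[of P, OF this, of card]
  obtain C where C: "P C" "\<And>D. P D \<Longrightarrow> card C \<le> card D" by blast
  have fin: "finite C" using C(1) assms(1) finite_subset unfolding P_def by blast
  have min: "D = C" if "D \<subseteq> C" "D \<noteq> {}" "f ` D \<subseteq> D" for D
  proof -
    have "P D" using that C(1) unfolding P_def by blast
    then show ?thesis using C(2) that(1) fin by (meson card_seteq)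
  qed
  have "f ` C = C" by (rule min) (use C(1) in \<open>auto simp: P_def\<close>)
  then have bij: "bij_betw f C C"
    using fin by (simp add: bij_betw_def finite_surj_inj)
  define p where "p = perm_on f C"
  have p: "p permutes C" unfolding p_def by (rule perm_on_permutes[OF bij])
  then have perm: "permutation p" using fin permutation_permutes by blast
  obtain x where x: "x \<in> C" using C(1) unfolding P_def by blast
  \<comment> \<open>\<open>cs\<close> lists the orbit of \<open>x\<close> under \<open>p\<close>;
    once it fills \<open>C\<close>, \<open>p\<close> is a single cycle.\<close>
  define cs where "cs = support p x"
  have pow: "(p ^^ n) x \<in> C" for n
    by (induction n) (use x p in \<open>auto simp: permutes_in_image\<close>)
  have supp: "set cs = range (\<lambda>n. (p ^^ n) x)"
    unfolding cs_def by (rule support_set[OF perm])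
  have cs: "set cs = C"
  proof (rule min)
    show "set cs \<subseteq> C" unfolding supp using pow by blast
    show "set cs \<noteq> {}" unfolding supp by blast
    show "f ` set cs \<subseteq> set cs"
    proof
      fix y assume "y \<in> f ` set cs"
      then obtain n where "y = f ((p ^^ n) x)" unfolding supp by blast
      then have "y = (p ^^ Suc n) x" using pow[of n] by (simp add: p_def perm_on_def)
      then show "y \<in> set cs" unfolding supp by blast
    qed
  qed
  have d: "distinct cs" unfolding cs_def by (rule cycle_of_permutation[OF perm])
  have "p = cycle_of_list cs"
  proof
    fix y show "p y = cycle_of_list cs y"
    proof (cases "y \<in> C")
      case True
      then show ?thesis using cycle_restrict[OF perm, of y x] cs unfolding cs_def by blast
    next
      case False
      then show ?thesis using id_outside_supp[of y cs] cs by (simp add: p_def perm_on_def)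
    qed
  qed
  moreover have "cs \<noteq> []" using cs x by auto
  ultimately have "sign p = - ((-1) ^ card C)"
    using sign_cycle_of_list[OF d] distinct_card[OF d] cs by simp
  moreover have "C \<subseteq> J" if "f ` J \<subseteq> J" "J \<inter> C \<noteq> {}" for J
  proof -
    have "J \<inter> C = C" by (rule min) (use that C(1) in \<open>auto simp: P_def\<close>)
    then show ?thesis by blast
  qed
  ultimately show thesis using that C(1) bij unfolding P_def p_def by blast
qed

text \<open>Adding or removing the points of one fixed cycle of \<open>f\<close> is a sign-reversing involution.\<close>

lemma sum_sign_perm_on_eq_0:
  assumes "finite X" "X \<noteq> {}" "f ` X \<subseteq> X"
  shows "(\<Sum>J | J \<subseteq> X \<and> bij_betw f J J. (-1) ^ card J * sign (perm_on f J)) = 0"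
proof -
  obtain C where C: "C \<subseteq> X" "C \<noteq> {}" "bij_betw f C C"
    "sign (perm_on f C) = - ((-1) ^ card C)"
    "\<And>J. f ` J \<subseteq> J \<Longrightarrow> J \<inter> C \<noteq> {} \<Longrightarrow> C \<subseteq> J"
    using minimal_closed_subset_cycle[OF assms] by blast
  let ?g = "\<lambda>J. (-1) ^ card J * sign (perm_on f J)"
  define A where "A = {J. J \<subseteq> X \<and> bij_betw f J J \<and> J \<inter> C = {}}"
  define B where "B = {J. J \<subseteq> X \<and> bij_betw f J J \<and> C \<subseteq> J}"
  have fin: "finite A" "finite B" using assms(1) by (auto simp: A_def B_def)
  have finC: "finite C" using C(1) assms(1) finite_subset by blast
  have AB: "{J. J \<subseteq> X \<and> bij_betw f J J} = A \<union> B"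
  proof -
    have "J \<inter> C = {} \<or> C \<subseteq> J" if "bij_betw f J J" for J
      using C(5)[of J] bij_betw_imp_surj_on[OF that] by auto
    then show ?thesis unfolding A_def B_def by blast
  qed
  have "A \<inter> B = {}" using C(2) by (auto simp: A_def B_def)
  moreover have "sum ?g B = (\<Sum>J\<in>A. - ?g J)"
  proof (rule sum.reindex_bij_witness[of _ "\<lambda>J. J \<union> C" "\<lambda>J. J - C"])
    fix J assume J: "J \<in> B"
    then show JA: "J - C \<in> A" using C(3) by (auto simp: A_def B_def intro: bij_betw_DiffI)
    show "J - C \<union> C = J" using J by (auto simp: B_def)
    define I where "I = J - C"
    have I: "bij_betw f I I" "I \<inter> C = {}" "finite I" and eq: "J = I \<union> C"
      using JA J assms(1) finite_subset by (auto simp: A_def B_def I_def)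
    \<comment> \<open>\<open>I\<close> and \<open>C\<close> are disjoint and \<open>f\<close>
      permutes each of them, so the signs multiply; \<open>C\<close> contributes
      \<open>(-1) ^ card C * sign (perm_on f C) = -1\<close>.\<close>
    have "perm_on f J = perm_on f I \<circ> perm_on f C"
      using I(2) C(3) by (auto simp: perm_on_def eq fun_eq_iff bij_betw_def)
    then have "sign (perm_on f J) = sign (perm_on f I) * sign (perm_on f C)"
      using perm_on_permutes[OF I(1)] perm_on_permutes[OF C(3)] I(3) finC
      by (metis permutation_permutes sign_compose)
    moreover have "card J = card I + card C" unfolding eq using I finC by (simp add: card_Un_disjoint)
    ultimately show "- ?g (J - C) = ?g J"
      by (simp add: C(4) power_add flip: I_def)
  next
    fix J assume "J \<in> A"
    then show "J \<union> C \<in> B" "J \<union> C - C = J"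
      using C(1,3) by (auto simp: A_def B_def intro: bij_betw_combine)
  qed
  ultimately show ?thesis unfolding AB using fin by (simp add: sum.union_disjoint sum_negf)
qed

subsection \<open>Reduction of the terms of the product\<close>

text \<open>\<open>q_var\<close> is a unit. Hence a biword over the alphabet contributes to the
  coefficient of \<open>\<delta>\<close> exactly if it sorts to \<open>\<delta>\<close>.\<close>

lemma q_var_power_nonzero: "q_var ^ k \<noteq> 0"
proof
  assume "q_var ^ k = 0"
  moreover have "q_var ^ k * q_inv ^ k = 1" by (simp add: q_var_q_inv flip: power_mult_distrib)
  ultimately show False by simp
qed

lemma map_fst_sorted_biword [simp]: "map fst (sorted_biword w) = sort w"
  and map_snd_sorted_biword [simp]: "map snd (sorted_biword w) = w"
  by (simp_all add: sorted_biword_def)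

lemma set_sorted_biword:
  assumes "w \<in> lists A"
  shows "set (sorted_biword w) \<subseteq> A \<times> A"
proof -
  have "set (sorted_biword w) \<subseteq> set (sort w) \<times> set w"
    unfolding sorted_biword_def by (auto dest: set_zip_leftD set_zip_rightD)
  then show ?thesis using assms by auto
qed

lemma perm_biword_eq_map: "perm_biword J \<sigma> = map (\<lambda>i. (\<sigma> i, i)) (sorted_list_of_set J)"
  by (simp add: perm_biword_def zip_map1 zip_same_conv_map)

lemma set_perm_biword:
  assumes "finite J" "\<sigma> permutes J"
  shows "set (perm_biword J \<sigma>) \<subseteq> J \<times> J"
  using assms by (auto simp: perm_biword_eq_map permutes_in_image)

text \<open>Since \<open>\<sigma>\<close> is a bijection of \<open>J\<close>, each top letter occurs
  once; these are the blocks needed for \<open>sort_key_eqI\<close>.\<close>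

lemma filter_perm_biword:
  assumes "finite J" "\<sigma> permutes J"
  shows "filter (\<lambda>p. fst p = x) (perm_biword J \<sigma>) = (if x \<in> J then [(x, inv \<sigma> x)] else [])"
proof -
  have single: "filter (\<lambda>i. i = k) L = (if k \<in> set L then [k] else [])" if "distinct L" for L and k :: nat
    using that by (induction L) (auto simp: filter_empty_conv)
  have "filter (\<lambda>p. fst p = x) (perm_biword J \<sigma>) =
      map (\<lambda>i. (\<sigma> i, i)) (filter (\<lambda>i. \<sigma> i = x) (sorted_list_of_set J))"
    by (simp add: perm_biword_eq_map filter_map o_def)
  also have "(\<lambda>i. \<sigma> i = x) = (\<lambda>i. i = inv \<sigma> x)"
    using assms(2) by (metis permutes_inverses)
  finally show ?thesis
    using assms by (simp add: single permutes_inverses permutes_in_image[OF permutes_inv])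
qed

lemma mset_perm_biword:
  assumes "finite J" "\<sigma> permutes J"
  shows "mset (map fst (perm_biword J \<sigma>)) = mset (map snd (perm_biword J \<sigma>))"
proof -
  have "mset (map \<sigma> (sorted_list_of_set J)) = mset (sorted_list_of_set J)"
    using assms permutes_inj_on[OF assms(2)]
    by (subst set_eq_iff_mset_eq_distinct[symmetric]) (auto simp: distinct_map permutes_image)
  then show ?thesis by (simp add: perm_biword_eq_map o_def)
qed

text \<open>The inversions between the two factors contribute equally to the top and to the bottom
  word, so the total power of \<open>q\<close> depends on the reduced biword only.\<close>

lemma Ferm_Bos_term_reduction:
  assumes J: "J \<subseteq> alphabet r" and \<sigma>: "\<sigma> permutes J" and w: "w \<in> lists (alphabet r)"
  defines "\<beta> \<equiv> perm_biword J \<sigma> @ sorted_biword w"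
  shows "(-1) ^ card J * (t_var ^ exc (perm_biword J \<sigma>) * (- q_inv) ^ perm_inv J \<sigma>) *
      (t_var ^ exc (sorted_biword w) * q_var ^ word_inv w) * red_biword r \<beta> (sort_key fst \<beta>) =
    of_int ((-1) ^ card J * sign \<sigma>) *
      (t_var ^ exc (sort_key fst \<beta>) * q_var ^ word_inv (map snd (sort_key fst \<beta>)))"
    (is ?eq)
    and "red_biword r \<beta> \<delta> \<noteq> 0 \<longleftrightarrow> sort_key fst \<beta> = \<delta>"
proof -
  have fin: "finite J" using J finite_subset by (auto simp: alphabet_def)
  let ?L = "sorted_list_of_set J"
  have "set (perm_biword J \<sigma>) \<subseteq> alphabet r \<times> alphabet r"
    using set_perm_biword[OF fin \<sigma>] J by blast
  then have "set \<beta> \<subseteq> alphabet r \<times> alphabet r"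
    using set_sorted_biword[OF w] by (simp add: \<beta>_def)
  then obtain k where k:
    "red_biword r \<beta> = (\<lambda>\<delta>. if \<delta> = sort_key fst \<beta> then q_var ^ k else 0)"
    "k + word_inv (map snd \<beta>) = word_inv (map fst \<beta>) + word_inv (map snd (sort_key fst \<beta>))"
    by (rule red_biword_eq)
  show "red_biword r \<beta> \<delta> \<noteq> 0 \<longleftrightarrow> sort_key fst \<beta> = \<delta>"
    using q_var_power_nonzero by (auto simp: k(1))
  define K where "K = word_inv (map snd (sort_key fst \<beta>))"
  let ?s = "perm_inv J \<sigma>"
  have top: "map fst (perm_biword J \<sigma>) = map \<sigma> ?L" and bot: "map snd (perm_biword J \<sigma>) = ?L"
    by (simp_all add: perm_biword_eq_map o_def)
  have "inv_between (map \<sigma> ?L) (sort w) = inv_between ?L w"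
    using mset_perm_biword[OF fin \<sigma>] unfolding top bot by (intro inv_between_mset_cong) auto
  \<comment> \<open>\<open>?L\<close> and \<open>sort w\<close> have no inversions and the cross
    terms are equal, so only \<open>?s\<close> on top and \<open>word_inv w\<close> at the bottom
    remain.\<close>
  then have exp: "k + word_inv w = ?s + K"
    using k(2) by (simp add: \<beta>_def top bot K_def word_inv_append word_inv_sorted perm_inv_def)
  have "exc (perm_biword J \<sigma>) + exc (sorted_biword w) = exc (sort_key fst \<beta>)"
    unfolding exc_append[symmetric] by (rule exc_mset_cong) (simp add: \<beta>_def)
  then have t: "t_var ^ exc (sort_key fst \<beta>) = t_var ^ exc (perm_biword J \<sigma>) * t_var ^ exc (sorted_biword w)"
    by (simp flip: power_add)
  \<comment> \<open>The \<open>?s\<close> extra powers of \<open>q_var\<close> cancel those of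
    \<open>q_inv\<close> and leave the sign \<open>(-1) ^ ?s\<close>.\<close>
  have "(- q_inv) ^ ?s * q_var ^ word_inv w * q_var ^ k = (- q_inv) ^ ?s * q_var ^ (?s + K)"
    by (simp add: exp[symmetric] power_add mult_ac)
  also have "\<dots> = (- (q_var * q_inv)) ^ ?s * q_var ^ K"
    by (simp add: power_add mult_ac flip: power_mult_distrib)
  also have "\<dots> = of_int (sign \<sigma>) * q_var ^ K"
    unfolding q_var_q_inv sign_perm_inv[OF fin \<sigma>, symmetric] by simp
  finally have q: "(- q_inv) ^ ?s * q_var ^ word_inv w * q_var ^ k = of_int (sign \<sigma>) * q_var ^ K" .
  have "(-1) ^ card J * (t_var ^ exc (perm_biword J \<sigma>) * (- q_inv) ^ ?s) *
      (t_var ^ exc (sorted_biword w) * q_var ^ word_inv w) * q_var ^ k =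
    (-1) ^ card J * t_var ^ exc (sort_key fst \<beta>) * ((- q_inv) ^ ?s * q_var ^ word_inv w * q_var ^ k)"
    unfolding t by (simp only: mult_ac)
  then show ?eq unfolding q by (simp add: k(1) K_def mult_ac)
qed

section \<open>Expansion of products of formal sums\<close>

lemma finite_append_splits: "finite {(\<beta>, \<gamma>). \<beta> @ \<gamma> = \<alpha>}"
proof (rule finite_subset)
  show "{(\<beta>, \<gamma>). \<beta> @ \<gamma> = \<alpha>} \<subseteq> (\<lambda>n. (take n \<alpha>, drop n \<alpha>)) ` {..length \<alpha>}"
  proof clarify
    fix \<beta> \<gamma> assume "\<alpha> = \<beta> @ \<gamma>"
    then show "(\<beta>, \<gamma>) \<in> (\<lambda>n. (take n (\<beta> @ \<gamma>), drop n (\<beta> @ \<gamma>))) ` {..length (\<beta> @ \<gamma>)}"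
      by (intro image_eqI[of _ _ "length \<beta>"]) auto
  qed
qed simp

lemma finite_formal_sum_pairs:
  assumes "\<And>\<alpha>. finite {i \<in> I. b i = \<alpha>}" "\<And>\<alpha>. finite {j \<in> I'. b' j = \<alpha>}" "finite N"
  shows "finite {(i, j) \<in> I \<times> I'. b i @ b' j \<in> N}"
proof (rule finite_subset)
  show "{(i, j) \<in> I \<times> I'. b i @ b' j \<in> N} \<subseteq>
    (\<Union>\<alpha>\<in>N. \<Union>(\<beta>, \<gamma>)\<in>{(\<beta>, \<gamma>). \<beta> @ \<gamma> = \<alpha>}. {i \<in> I. b i = \<beta>} \<times> {j \<in> I'. b' j = \<gamma>})"
    by auto
  show "finite \<dots>"
    using assms finite_append_splits by (intro finite_UN_I) (auto split: prod.splits)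
qed

text \<open>The index sets may be infinite, but each coefficient involves finitely many index pairs;
  these are grouped by the two biwords they produce.\<close>

lemma series_mult_formal_sum:
  assumes "\<And>\<alpha>. finite {i \<in> I. b i = \<alpha>}" "\<And>\<alpha>. finite {j \<in> I'. b' j = \<alpha>}"
  shows "series_mult (formal_sum I c b) (formal_sum I' c' b') \<alpha> =
    (\<Sum>(i, j)\<in>{(i, j) \<in> I \<times> I'. b i @ b' j = \<alpha>}. c i * c' j)"
proof -
  let ?S = "{(i, j) \<in> I \<times> I'. b i @ b' j = \<alpha>}"
  let ?T = "{(\<beta>, \<gamma>). \<beta> @ \<gamma> = \<alpha>}"
  have fin: "finite ?S" using finite_formal_sum_pairs[OF assms, of "{\<alpha>}"] by simp
  have "(\<Sum>(i, j)\<in>?S. c i * c' j) =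
      (\<Sum>p\<in>?T. \<Sum>x\<in>{x \<in> ?S. (case x of (i, j) \<Rightarrow> (b i, b' j)) = p}. case x of (i, j) \<Rightarrow> c i * c' j)"
    by (rule sum.group[symmetric]) (use fin finite_append_splits in auto)
  also have "\<dots> = (\<Sum>(\<beta>, \<gamma>)\<in>?T. formal_sum I c b \<beta> * formal_sum I' c' b' \<gamma>)"
  proof (rule sum.cong[OF refl])
    fix p assume p: "p \<in> ?T"
    obtain \<beta> \<gamma> where \<beta>: "p = (\<beta>, \<gamma>)" by fastforce
    have "{x \<in> ?S. (case x of (i, j) \<Rightarrow> (b i, b' j)) = p} = {i \<in> I. b i = \<beta>} \<times> {j \<in> I'. b' j = \<gamma>}"
      using p \<beta> by auto
    then show "(\<Sum>x\<in>{x \<in> ?S. (case x of (i, j) \<Rightarrow> (b i, b' j)) = p}. case x of (i, j) \<Rightarrow> c i * c' j) =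
        (case p of (\<beta>, \<gamma>) \<Rightarrow> formal_sum I c b \<beta> * formal_sum I' c' b' \<gamma>)"
      by (simp add: \<beta> formal_sum_def sum_product sum.cartesian_product)
  qed
  finally show ?thesis by (simp add: series_mult_def)
qed

text \<open>The same regrouping, now by the product biword, writes a coefficient as a sum over index
  pairs, so that cancellation can be studied on the indices.\<close>

lemma leftmost_reduction_mult_formal_sum:
  assumes "\<And>\<alpha>. finite {i \<in> I. b i = \<alpha>}" "\<And>\<alpha>. finite {j \<in> I'. b' j = \<alpha>}"
  shows "leftmost_reduction r (series_mult (formal_sum I c b) (formal_sum I' c' b')) \<delta> =
    (\<Sum>(i, j)\<in>{(i, j) \<in> I \<times> I'. red_biword r (b i @ b' j) \<delta> \<noteq> 0}.
      c i * c' j * red_biword r (b i @ b' j) \<delta>)"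
proof -
  let ?N = "{\<beta>. red_biword r \<beta> \<delta> \<noteq> 0}"
  let ?S = "{(i, j) \<in> I \<times> I'. red_biword r (b i @ b' j) \<delta> \<noteq> 0}"
  let ?h = "\<lambda>(i, j). c i * c' j * red_biword r (b i @ b' j) \<delta>"
  have fin: "finite ?S"
    using finite_formal_sum_pairs[OF assms finite_red_biword_support[of r \<delta>]] by simp
  have "sum ?h ?S = (\<Sum>\<beta>\<in>?N. \<Sum>x\<in>{x \<in> ?S. (case x of (i, j) \<Rightarrow> b i @ b' j) = \<beta>}. ?h x)"
    by (rule sum.group[symmetric]) (use fin finite_red_biword_support in auto)
  also have "\<dots> = (\<Sum>\<beta>\<in>?N. series_mult (formal_sum I c b) (formal_sum I' c' b') \<beta> * red_biword r \<beta> \<delta>)"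
  proof (rule sum.cong[OF refl])
    fix \<beta> assume "\<beta> \<in> ?N"
    then have eq: "{x \<in> ?S. (case x of (i, j) \<Rightarrow> b i @ b' j) = \<beta>} = {(i, j) \<in> I \<times> I'. b i @ b' j = \<beta>}"
      by auto
    show "(\<Sum>x\<in>{x \<in> ?S. (case x of (i, j) \<Rightarrow> b i @ b' j) = \<beta>}. ?h x) =
        series_mult (formal_sum I c b) (formal_sum I' c' b') \<beta> * red_biword r \<beta> \<delta>"
      unfolding eq series_mult_formal_sum[OF assms] sum_distrib_right
      by (rule sum.cong) auto
  qed
  finally show ?thesis by (simp add: leftmost_reduction_def)
qed

subsection \<open>Factorizations of a sorted biword\<close>

text \<open>Stable sorting puts the biletter of the first factor before those of the second with the
  same top, so removing the first biletter over each letter of \<open>J\<close> recovers the second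
  factor.\<close>

fun remove_first_tops :: "'a set \<Rightarrow> ('a \<times> 'b) list \<Rightarrow> ('a \<times> 'b) list" where
  "remove_first_tops J [] = []"
| "remove_first_tops J (p # \<delta>) =
    (if fst p \<in> J then remove_first_tops (J - {fst p}) \<delta> else p # remove_first_tops J \<delta>)"

lemma filter_remove_first_tops:
  "filter (\<lambda>p. fst p = x) (remove_first_tops J \<delta>) =
    (if x \<in> J then tl (filter (\<lambda>p. fst p = x) \<delta>) else filter (\<lambda>p. fst p = x) \<delta>)"
  by (induction J \<delta> rule: remove_first_tops.induct) auto

lemma set_remove_first_tops: "set (remove_first_tops J \<delta>) \<subseteq> set \<delta>"
  by (induction J \<delta> rule: remove_first_tops.induct) auto

lemma sorted_remove_first_tops:
  "sorted (map fst \<delta>) \<Longrightarrow> sorted (map fst (remove_first_tops J \<delta>))"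
  by (induction J \<delta> rule: remove_first_tops.induct) (use set_remove_first_tops in fastforce)+

text \<open>These are the pairs of an index of \<open>Ferm r\<close> and one of \<open>Bos r\<close>
  whose product reduces to a multiple of \<open>\<delta>\<close>; the nesting follows the index
  types there.\<close>

definition factorizations :: "nat \<Rightarrow> biword \<Rightarrow> ((nat set \<times> (nat \<Rightarrow> nat)) \<times> nat list) set" where
  "factorizations r \<delta> = {((J, \<sigma>), w). J \<subseteq> alphabet r \<and> \<sigma> permutes J \<and> w \<in> lists (alphabet r) \<and>
     sort_key fst (perm_biword J \<sigma> @ sorted_biword w) = \<delta>}"

text \<open>By \<open>Ferm_Bos_term_reduction\<close> all contributing terms carry the monomial of
  \<open>\<delta>\<close>, so it factors out and leaves a signed count.\<close>

lemma leftmost_reduction_Ferm_Bos: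
  "leftmost_reduction r (series_mult (Ferm r) (Bos r)) \<delta> =
    of_int (\<Sum>((J, \<sigma>), w)\<in>factorizations r \<delta>. (-1) ^ card J * sign \<sigma>) *
      (t_var ^ exc \<delta> * q_var ^ word_inv (map snd \<delta>))"
proof -
  let ?I = "SIGMA J : Pow (alphabet r). {\<sigma>. \<sigma> permutes J}"
  let ?c = "\<lambda>(J, \<sigma>). (-1) ^ card J * (t_var ^ exc (perm_biword J \<sigma>) * (- q_inv) ^ perm_inv J \<sigma>)"
  let ?b = "\<lambda>(J, \<sigma>). perm_biword J \<sigma>"
  let ?d = "\<lambda>w. t_var ^ exc (sorted_biword w) * q_var ^ word_inv w"
  have "leftmost_reduction r (series_mult (Ferm r) (Bos r)) \<delta> =
    (\<Sum>(i, w)\<in>{(i, w) \<in> ?I \<times> lists (alphabet r). red_biword r (?b i @ sorted_biword w) \<delta> \<noteq> 0}.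
      ?c i * ?d w * red_biword r (?b i @ sorted_biword w) \<delta>)"
    unfolding Ferm_def Bos_def
    by (rule leftmost_reduction_mult_formal_sum[OF finite_Ferm_terms finite_Bos_terms])
  also have "\<dots> = (\<Sum>((J, \<sigma>), w)\<in>factorizations r \<delta>. of_int ((-1) ^ card J * sign \<sigma>) *
      (t_var ^ exc \<delta> * q_var ^ word_inv (map snd \<delta>)))"
  proof (rule sum.cong)
    show "{(i, w) \<in> ?I \<times> lists (alphabet r). red_biword r (?b i @ sorted_biword w) \<delta> \<noteq> 0} =
        factorizations r \<delta>"
    proof (rule set_eqI)
      fix x :: "(nat set \<times> (nat \<Rightarrow> nat)) \<times> nat list"
      obtain J \<sigma> w where x: "x = ((J, \<sigma>), w)" by (metis surj_pair)
      show "x \<in> {(i, w) \<in> ?I \<times> lists (alphabet r). red_biword r (?b i @ sorted_biword w) \<delta> \<noteq> 0} \<longleftrightarrow>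
          x \<in> factorizations r \<delta>"
        using Ferm_Bos_term_reduction(2)[of J r \<sigma> w \<delta>] by (auto simp: x factorizations_def)
    qed
    fix x assume "x \<in> factorizations r \<delta>"
    then obtain J \<sigma> w where x: "x = ((J, \<sigma>), w)" "J \<subseteq> alphabet r" "\<sigma> permutes J"
      "w \<in> lists (alphabet r)" "sort_key fst (perm_biword J \<sigma> @ sorted_biword w) = \<delta>"
      unfolding factorizations_def by blast
    show "(case x of (i, w) \<Rightarrow> ?c i * ?d w * red_biword r (?b i @ sorted_biword w) \<delta>) =
      (\<lambda>((J, \<sigma>), w). of_int ((-1) ^ card J * sign \<sigma>) *
        (t_var ^ exc \<delta> * q_var ^ word_inv (map snd \<delta>))) x"
      using Ferm_Bos_term_reduction(1)[OF x(2-4)] by (simp only: x(1,5) prod.case)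
  qed
  also have "\<dots> = of_int (\<Sum>((J, \<sigma>), w)\<in>factorizations r \<delta>. (-1) ^ card J * sign \<sigma>) *
      (t_var ^ exc \<delta> * q_var ^ word_inv (map snd \<delta>))"
    by (simp add: sum_distrib_right case_prod_unfold)
  finally show ?thesis .
qed

text \<open>Sorting preserves length, so both factors are empty. This yields the constant term
  1.\<close>

lemma factorizations_Nil: "factorizations r [] = {(({}, id), [])}"
proof -
  have "J = {} \<and> \<sigma> = id \<and> w = []"
    if "J \<subseteq> alphabet r" "\<sigma> permutes J" "sort_key fst (perm_biword J \<sigma> @ sorted_biword w) = []" for J \<sigma> w
  proof -
    have "perm_biword J \<sigma> @ sorted_biword w = []"
      using that(3) by (metis length_0_conv length_sort)
    then have "perm_biword J \<sigma> = []" "map snd (sorted_biword w) = []" by auto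
    moreover have "finite J" using that(1) finite_subset by (auto simp: alphabet_def)
    ultimately show ?thesis using that(2)
      by (auto simp: perm_biword_eq_map permutes_empty)
  qed
  then show ?thesis
    by (auto simp: factorizations_def perm_biword_eq_map sorted_biword_def permutes_id)
qed

text \<open>Under each top letter \<open>x \<in> J\<close>, a factorization puts \<open>\<sigma>\<inverse> x\<close> in front; hence it is
  determined by \<open>J\<close>, and \<open>\<sigma>\<inverse>\<close> is the restriction to \<open>J\<close> of the map that sends \<open>x\<close> to the first
  bottom letter under \<open>x\<close>.\<close>

lemma sum_factorizations_eq_0:
  assumes "\<delta> \<noteq> []"
  shows "(\<Sum>((J, \<sigma>), w)\<in>factorizations r \<delta>. (-1) ^ card J * sign \<sigma>) = 0"
proof (cases "factorizations r \<delta> = {}")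
  \<comment> \<open>The facts needed about \<open>\<delta>\<close> are read off from one
    factorization; if there is none, the sum is empty.\<close>
  case False
  let ?at = "\<lambda>x. filter (\<lambda>p. fst p = x)"
  \<comment> \<open>This is meaningful for \<open>x \<in> X\<close>, where the filtered list is
    nonempty.\<close>
  define f where "f x = snd (hd (?at x \<delta>))" for x
  define X where "X = fst ` set \<delta>"
  have fact_at: "?at x \<delta> = (if x \<in> J then [(x, inv \<sigma> x)] else []) @ ?at x (sorted_biword w)"
    if "((J, \<sigma>), w) \<in> factorizations r \<delta>" for J \<sigma> w x
  proof -
    have *: "J \<subseteq> alphabet r" "\<sigma> permutes J" "\<delta> = sort_key fst (perm_biword J \<sigma> @ sorted_biword w)"
      using that by (auto simp: factorizations_def)
    then have "finite J" using finite_subset by (auto simp: alphabet_def)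
    then show ?thesis unfolding *(3) sort_key_stable using *(2) by (simp add: filter_perm_biword)
  qed
  have \<delta>: "sorted (map fst \<delta>)" "mset (map fst \<delta>) = mset (map snd \<delta>)"
    "set \<delta> \<subseteq> alphabet r \<times> alphabet r"
  proof -
    obtain J \<sigma> w where *: "J \<subseteq> alphabet r" "\<sigma> permutes J" "w \<in> lists (alphabet r)"
      "\<delta> = sort_key fst (perm_biword J \<sigma> @ sorted_biword w)"
      using False by (auto simp: factorizations_def)
    have fin: "finite J" using *(1) finite_subset by (auto simp: alphabet_def)
    show "sorted (map fst \<delta>)" unfolding *(4) by simp
    have m: "mset \<delta> = mset (perm_biword J \<sigma> @ sorted_biword w)" unfolding *(4) by simp
    have "mset (map g \<delta>) = mset (map g (perm_biword J \<sigma>)) + mset (map g (sorted_biword w))"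
      for g :: "nat \<times> nat \<Rightarrow> nat"
      unfolding mset_map m by simp
    then show "mset (map fst \<delta>) = mset (map snd \<delta>)"
      using mset_perm_biword[OF fin *(2)] by (simp del: mset_map)
    have "set (perm_biword J \<sigma>) \<subseteq> alphabet r \<times> alphabet r"
      using set_perm_biword[OF fin *(2)] *(1) by blast
    then show "set \<delta> \<subseteq> alphabet r \<times> alphabet r"
      using set_sorted_biword[OF *(3)] mset_eq_setD[OF m] by simp
  qed
  have at_f: "?at x \<delta> = (x, f x) # tl (?at x \<delta>)" "(x, f x) \<in> set \<delta>" if "x \<in> X" for x
  proof -
    have "?at x \<delta> \<noteq> []" using that by (auto simp: X_def filter_empty_conv)
    then have "hd (?at x \<delta>) \<in> set (?at x \<delta>)" by (rule hd_in_set)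
    then have h: "hd (?at x \<delta>) = (x, f x)" "hd (?at x \<delta>) \<in> set \<delta>" by (auto simp: f_def prod_eq_iff)
    then show "?at x \<delta> = (x, f x) # tl (?at x \<delta>)" "(x, f x) \<in> set \<delta>"
      using \<open>?at x \<delta> \<noteq> []\<close> by (metis list.collapse, simp)
  qed
  have X: "finite X" "X \<noteq> {}" "f ` X \<subseteq> X" "X \<subseteq> alphabet r"
  proof -
    \<comment> \<open>Top and bottom word have equal content, so every bottom letter, in particular
      \<open>f x\<close>, is again a top letter.\<close>
    have "fst ` set \<delta> = snd ` set \<delta>" using mset_eq_setD[OF \<delta>(2)] by simp
    then show "f ` X \<subseteq> X" using at_f(2) unfolding X_def by (metis image_subsetI imageI snd_conv)
  qed (use assms \<delta>(3) in \<open>auto simp: X_def\<close>)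
  have fact_f: "J \<subseteq> X \<and> perm_on f J = inv \<sigma> \<and> bij_betw f J J"
    if "((J, \<sigma>), w) \<in> factorizations r \<delta>" for J \<sigma> w
  proof -
    have \<sigma>: "\<sigma> permutes J" using that by (auto simp: factorizations_def)
    have fx: "f x = inv \<sigma> x" "x \<in> X" if "x \<in> J" for x
    proof -
      have "?at x \<delta> = (x, inv \<sigma> x) # ?at x (sorted_biword w)"
        using fact_at[OF \<open>((J, \<sigma>), w) \<in> _\<close>] \<open>x \<in> J\<close> by simp
      then show "f x = inv \<sigma> x" by (simp add: f_def)
      have "(x, inv \<sigma> x) \<in> set (?at x \<delta>)" unfolding \<open>?at x \<delta> = _\<close> by simp
      then show "x \<in> X" by (force simp: X_def)
    qed
    moreover have "inv \<sigma> x = x" if "x \<notin> J" for x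
      using permutes_not_in[OF permutes_inv[OF \<sigma>] that] .
    moreover have "bij_betw f J J"
      using permutes_imp_bij[OF permutes_inv[OF \<sigma>]] fx(1) by (simp cong: bij_betw_cong)
    ultimately show ?thesis by (auto simp: perm_on_def fun_eq_iff)
  qed
  have "(\<Sum>((J, \<sigma>), w)\<in>factorizations r \<delta>. (-1) ^ card J * sign \<sigma>) =
      (\<Sum>J | J \<subseteq> X \<and> bij_betw f J J. (-1) ^ card J * sign (perm_on f J))"
  proof (rule sum.reindex_bij_witness[of _
        "\<lambda>J. ((J, inv (perm_on f J)), map snd (remove_first_tops J \<delta>))" "\<lambda>p. fst (fst p)"])
    fix x assume x_in: "x \<in> factorizations r \<delta>"
    obtain J \<sigma> w where x: "x = ((J, \<sigma>), w)" by (metis surj_pair)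
    note fact = x_in[unfolded x]
    have J: "J \<subseteq> X" "perm_on f J = inv \<sigma>" "bij_betw f J J" using fact_f[OF fact] by auto
    have \<sigma>: "\<sigma> permutes J" using fact by (auto simp: factorizations_def)
    have fin: "finite J" using J(1) X(1) finite_subset by blast
    show "fst (fst x) \<in> {J. J \<subseteq> X \<and> bij_betw f J J}" using J by (simp add: x)
    have eq: "?at y (remove_first_tops J \<delta>) = ?at y (sorted_biword w)" for y
      using fact_at[OF fact, of y] by (simp add: filter_remove_first_tops)
    have "sort_key fst (sorted_biword w) = remove_first_tops J \<delta>"
      by (rule sort_key_eqI) (use eq \<delta>(1) in \<open>simp_all add: sorted_remove_first_tops\<close>)
    moreover have "sort_key fst (sorted_biword w) = sorted_biword w"
      by (rule sort_key_eqI) simp_all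
    ultimately have "map snd (remove_first_tops J \<delta>) = w" by (metis map_snd_sorted_biword)
    then show "((fst (fst x), inv (perm_on f (fst (fst x)))),
        map snd (remove_first_tops (fst (fst x)) \<delta>)) = x"
      using J(2) permutes_inv_inv[OF \<sigma>] by (simp add: x)
    have "sign (inv \<sigma>) = sign \<sigma>" using fin \<sigma> permutation_permutes sign_inverse by blast
    then show "(-1) ^ card (fst (fst x)) * sign (perm_on f (fst (fst x))) =
        (\<lambda>((J, \<sigma>), w). (-1) ^ card J * sign \<sigma>) x"
      by (simp add: x J(2))
  next
    fix J assume "J \<in> {J. J \<subseteq> X \<and> bij_betw f J J}"
    then have J: "J \<subseteq> X" "bij_betw f J J" by auto
    have fin: "finite J" using J(1) X(1) finite_subset by blast
    define \<sigma> where "\<sigma> = inv (perm_on f J)"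
    define R where "R = remove_first_tops J \<delta>"
    have p: "perm_on f J permutes J" by (rule perm_on_permutes[OF J(2)])
    then have \<sigma>: "\<sigma> permutes J" unfolding \<sigma>_def by (rule permutes_inv)
    have inv_\<sigma>: "inv \<sigma> = perm_on f J" unfolding \<sigma>_def by (rule permutes_inv_inv[OF p])
    \<comment> \<open>Conversely, over \<open>x \<in> J\<close> the first biletter
      \<open>(x, f x)\<close> is supplied by \<open>perm_biword J \<sigma>\<close>, and the rest by
      \<open>R\<close>.\<close>
    have "?at x \<delta> = ?at x (perm_biword J \<sigma> @ R)" for x
      using at_f(1)[of x] J(1) fin \<sigma>
      by (auto simp: filter_perm_biword inv_\<sigma> perm_on_def R_def filter_remove_first_tops)
    then have sort: "sort_key fst (perm_biword J \<sigma> @ R) = \<delta>"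
      by (intro sort_key_eqI \<delta>(1))
    \<comment> \<open>Cancelling the equal contents of the first factor shows that the bottom word
      of \<open>R\<close> rearranges its sorted top word, so \<open>R\<close> is a
      \<open>sorted_biword\<close>.\<close>
    have "mset (map g (perm_biword J \<sigma>)) + mset (map g R) = mset (map g \<delta>)"
      for g :: "nat \<times> nat \<Rightarrow> nat"
      unfolding mset_map sort[symmetric] by simp
    from this[of fst] this[of snd] have "mset (map fst R) = mset (map snd R)"
      unfolding mset_perm_biword[OF fin \<sigma>] \<delta>(2) by (metis add_left_imp_eq)
    moreover have "sorted (map fst R)" unfolding R_def by (rule sorted_remove_first_tops[OF \<delta>(1)])
    ultimately have "sort (map snd R) = map fst R" by (intro properties_for_sort) auto
    then have "sorted_biword (map snd R) = R" by (simp add: sorted_biword_def zip_map_fst_snd)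
    moreover have "map snd R \<in> lists (alphabet r)"
      using set_remove_first_tops[of J \<delta>] \<delta>(3) unfolding R_def by fastforce
    ultimately have "((J, \<sigma>), map snd R) \<in> factorizations r \<delta>"
      using J(1) X(4) \<sigma> sort by (auto simp: factorizations_def)
    then show "((J, inv (perm_on f J)), map snd (remove_first_tops J \<delta>)) \<in> factorizations r \<delta>"
      unfolding \<sigma>_def R_def .
  qed simp
  also have "\<dots> = 0" by (rule sum_sign_perm_on_eq_0[OF X(1-3)])
  finally show ?thesis .
qed simp

theorem mainTheorem2:
  fixes r :: nat
  assumes "r \<ge> 1"
  shows "leftmost_reduction r (series_mult (Ferm r) (Bos r)) = series_one"
proof
  fix \<delta>
  show "leftmost_reduction r (series_mult (Ferm r) (Bos r)) \<delta> = series_one \<delta>"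
  proof (cases "\<delta> = []")
    case True
    then show ?thesis
      by (simp add: leftmost_reduction_Ferm_Bos factorizations_Nil series_one_def
          exc_eq_length_filter)
  next
    case False
    then show ?thesis
      by (simp add: leftmost_reduction_Ferm_Bos sum_factorizations_eq_0 series_one_def)
  qed
qed

end
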